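(* Let $r\ge1$. The map $$\mathrm{Sym}^r(S^1\times S^1)\to S^1\times S^1,\qquad \{(\lambda_1,\mu_1),\dots,(\lambda_r,\mu_r)\}\mapsto(\lambda_1\cdots\lambda_r,\ \mu_1\cdots\mu_r),$$ is a Zariski locally trivial fibration whose fiber is isomorphic to $\mathrm{SSym}^r(S^1\times S^1)$.
   Context: $S^1\subset\mathbb{C}$ is the unit circle. $\mathrm{Sym}^r(X)=X^r/S_r$ is the $r$-fold symmetric product, the symmetric group permuting the factors. $\mathrm{SSym}^r(S^1\times S^1)\subset\mathrm{Sym}^r(S^1\times S^1)$ is the subset of $\{(\lambda_1,\mu_1),\dots,(\lambda_r,\mu_r)\}$ with $\lambda_1\cdots\lambda_r=\mu_1\cdots\mu_r=1$. "Zariski locally trivial" means that every point of the base has a neighbourhood $U$, open in the (real) Zariski topology of the base, over which the map is isomorphic, as a map of topological spaces, to the projection $U\times(\text{fiber})\to U$. *)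

theory Defs
  imports "HOL-Analysis.Analysis" "HOL-Combinatorics.Permutations"
begin

definition quotient_topology :: "'a topology \<Rightarrow> ('a \<times> 'a) set \<Rightarrow> 'a set topology" where
  "quotient_topology X R =
     topology (\<lambda>W. W \<subseteq> topspace X // R \<and> openin X (\<Union>W))"

lemma openin_quotient_topology:
  assumes R: "equiv (topspace X) R"
  shows "openin (quotient_topology X R) W \<longleftrightarrow> W \<subseteq> topspace X // R \<and> openin X (\<Union>W)"
proof -
  have Int: "\<Union>(V \<inter> W) = \<Union>V \<inter> \<Union>W"
    if "V \<subseteq> topspace X // R" "W \<subseteq> topspace X // R" for V W
  proof
    show "\<Union>V \<inter> \<Union>W \<subseteq> \<Union>(V \<inter> W)"
    proof
      fix x assume "x \<in> \<Union>V \<inter> \<Union>W"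
      then obtain A B where AB: "A \<in> V" "B \<in> W" "x \<in> A" "x \<in> B" by blast
      with that quotient_disj[OF R, of A B] have "A = B" by blast
      with AB show "x \<in> \<Union>(V \<inter> W)" by blast
    qed
  qed blast
  have "istopology (\<lambda>W. W \<subseteq> topspace X // R \<and> openin X (\<Union>W))"
    unfolding istopology_def
  proof (intro conjI allI impI)
    fix \<W> assume *: "\<forall>W\<in>\<W>. W \<subseteq> topspace X // R \<and> openin X (\<Union>W)"
    then show "\<Union>\<W> \<subseteq> topspace X // R" by blast
    have "\<Union>(\<Union>\<W>) = \<Union>(Union ` \<W>)" by blast
    moreover have "openin X (\<Union>(Union ` \<W>))" using * by (intro openin_Union) blast
    ultimately show "openin X (\<Union>(\<Union>\<W>))" by simp
  qed (auto simp: Int)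
  then show ?thesis
    by (simp add: quotient_topology_def)
qed

lemma topspace_quotient_topology:
  assumes R: "equiv (topspace X) R"
  shows "topspace (quotient_topology X R) = topspace X // R"
proof
  show "topspace (quotient_topology X R) \<subseteq> topspace X // R"
    using openin_topspace openin_quotient_topology[OF R] by blast
  have "openin (quotient_topology X R) (topspace X // R)"
    by (simp add: openin_quotient_topology[OF R] Union_quotient[OF R])
  then show "topspace X // R \<subseteq> topspace (quotient_topology X R)"
    by (rule openin_subset)
qed

text \<open>A point of the \<open>r\<close>-fold power of \<open>X\<close> is an (extensional) function on the index set
  \<open>{..<r}\<close>, and a point of the symmetric product is an orbit of the symmetric group on that index
  set, that is, a set of such functions.\<close>

definition perm_rel :: "nat \<Rightarrow> 'a topology \<Rightarrow> ((nat \<Rightarrow> 'a) \<times> (nat \<Rightarrow> 'a)) set" where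
  "perm_rel r X = {(x, y). x \<in> topspace (product_topology (\<lambda>_. X) {..<r}) \<and>
                           (\<exists>\<sigma>. \<sigma> permutes {..<r} \<and> y = x \<circ> \<sigma>)}"

definition Sym :: "nat \<Rightarrow> 'a topology \<Rightarrow> (nat \<Rightarrow> 'a) set topology" where
  "Sym r X = quotient_topology (product_topology (\<lambda>_. X) {..<r}) (perm_rel r X)"

lemma comp_permutes_in_power:
  assumes "x \<in> topspace (product_topology (\<lambda>_. X) {..<r})" "\<sigma> permutes {..<r}"
  shows "x \<circ> \<sigma> \<in> topspace (product_topology (\<lambda>_. X) {..<r})"
  using assms permutes_in_image[OF assms(2)] permutes_not_in[OF assms(2)]
  by (auto simp: PiE_iff extensional_def)

lemma equiv_perm_rel:
  "equiv (topspace (product_topology (\<lambda>_. X) {..<r})) (perm_rel r X)"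
proof (rule equivI)
  let ?P = "topspace (product_topology (\<lambda>_. X) {..<r})"
  show "perm_rel r X \<subseteq> ?P \<times> ?P"
  proof
    fix z assume "z \<in> perm_rel r X"
    then obtain x \<sigma> where "z = (x, x \<circ> \<sigma>)" "x \<in> ?P" "\<sigma> permutes {..<r}"
      unfolding perm_rel_def by blast
    then show "z \<in> ?P \<times> ?P"
      using comp_permutes_in_power by blast
  qed
  show "refl_on ?P (perm_rel r X)"
  proof (rule refl_onI)
    fix x assume "x \<in> ?P"
    moreover have "x = x \<circ> id" by simp
    ultimately show "(x, x) \<in> perm_rel r X"
      unfolding perm_rel_def using permutes_id by blast
  qed
  show "sym (perm_rel r X)"
  proof (rule symI)
    fix x y assume "(x, y) \<in> perm_rel r X"
    then obtain \<sigma> where x: "x \<in> ?P" and \<sigma>: "\<sigma> permutes {..<r}" and y: "y = x \<circ> \<sigma>"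
      unfolding perm_rel_def by blast
    have "x = y \<circ> inv \<sigma>"
      using y permutes_inv_o(1)[OF \<sigma>] by (simp add: comp_assoc)
    with comp_permutes_in_power[OF x \<sigma>] permutes_inv[OF \<sigma>] y
    show "(y, x) \<in> perm_rel r X"
      unfolding perm_rel_def by blast
  qed
  show "trans (perm_rel r X)"
  proof (rule transI)
    fix x y z assume "(x, y) \<in> perm_rel r X" "(y, z) \<in> perm_rel r X"
    then obtain \<sigma> \<tau> where *: "x \<in> ?P" "\<sigma> permutes {..<r}" "\<tau> permutes {..<r}"
      and "y = x \<circ> \<sigma>" "z = y \<circ> \<tau>"
      unfolding perm_rel_def by blast
    then have "z = x \<circ> (\<sigma> \<circ> \<tau>)"
      by (simp only: comp_assoc)
    with *(1) permutes_compose[OF *(3,2)] show "(x, z) \<in> perm_rel r X"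
      unfolding perm_rel_def by blast
  qed
qed

abbreviation S1 :: "complex set" where
  "S1 \<equiv> sphere 0 1"

abbreviation torus :: "(complex \<times> complex) topology" where
  "torus \<equiv> prod_topology (top_of_set S1) (top_of_set S1)"

definition tuple_mult :: "nat \<Rightarrow> (nat \<Rightarrow> complex \<times> complex) \<Rightarrow> complex \<times> complex" where
  "tuple_mult r x = (\<Prod>i<r. fst (x i), \<Prod>i<r. snd (x i))"

text \<open>The map induced by \<^const>\<open>tuple_mult\<close> on orbits; it is well defined by
  \<open>Sym_mult_class\<close> below.\<close>

definition Sym_mult :: "nat \<Rightarrow> (nat \<Rightarrow> complex \<times> complex) set \<Rightarrow> complex \<times> complex" where
  "Sym_mult r c = the_elem (tuple_mult r ` c)"

lemma tuple_mult_permutes: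
  assumes "\<sigma> permutes {..<r}"
  shows "tuple_mult r (x \<circ> \<sigma>) = tuple_mult r x"
  using prod.permute[OF assms, of "\<lambda>i. fst (x i)"] prod.permute[OF assms, of "\<lambda>i. snd (x i)"]
  by (simp add: tuple_mult_def comp_def)

lemma Sym_mult_class:
  assumes "x \<in> topspace (product_topology (\<lambda>_. X) {..<r})"
  shows "Sym_mult r (perm_rel r X `` {x}) = tuple_mult r x"
proof -
  have "x \<in> perm_rel r X `` {x}"
    using equiv_class_self[OF equiv_perm_rel assms] .
  moreover have "tuple_mult r y = tuple_mult r x" if "y \<in> perm_rel r X `` {x}" for y
    using that tuple_mult_permutes by (auto simp: perm_rel_def)
  ultimately have "tuple_mult r ` (perm_rel r X `` {x}) = {tuple_mult r x}"
    by blast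
  then show ?thesis
    by (simp add: Sym_mult_def)
qed

definition SSym :: "nat \<Rightarrow> (nat \<Rightarrow> complex \<times> complex) set topology" where
  "SSym r = subtopology (Sym r torus)
     {perm_rel r torus `` {x} | x. x \<in> topspace (product_topology (\<lambda>_. torus) {..<r}) \<and>
        (\<Prod>i<r. fst (x i)) = 1 \<and> (\<Prod>i<r. snd (x i)) = 1}"

text \<open>The real Zariski topology of a subset \<open>S\<close> of a Euclidean space: the closed sets are the
  common zero loci in \<open>S\<close> of sets of real polynomials in the real coordinates. For
  \<open>S \<subseteq> \<complex> \<times> \<complex>\<close> these are the four coordinates of \<open>\<real>\<^sup>4\<close>.\<close>

definition real_zariski :: "'a::euclidean_space set \<Rightarrow> 'a topology" where
  "real_zariski S =
     topology (\<lambda>U. \<exists>P \<subseteq> Collect real_polynomial_function. U = S - {x \<in> S. \<forall>f\<in>P. f x = 0})"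

lemma openin_real_zariski:
  "openin (real_zariski S) U \<longleftrightarrow>
     (\<exists>P \<subseteq> Collect real_polynomial_function. U = S - {x \<in> S. \<forall>f\<in>P. f x = 0})"
proof -
  let ?open = "\<lambda>U. \<exists>P \<subseteq> Collect real_polynomial_function. U = S - {x \<in> S. \<forall>f\<in>P. f x = 0}"
  have "istopology ?open"
    unfolding istopology_def
  proof (intro conjI allI impI)
    fix U V assume "?open U" "?open V"
    then obtain P Q where P: "P \<subseteq> Collect real_polynomial_function" "U = S - {x \<in> S. \<forall>f\<in>P. f x = 0}"
      and Q: "Q \<subseteq> Collect real_polynomial_function" "V = S - {x \<in> S. \<forall>f\<in>Q. f x = 0}"
      by auto
    let ?PQ = "(\<lambda>(f, g) x. f x * g x) ` (P \<times> Q)"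
    have "real_polynomial_function (\<lambda>x. f x * g x)" if "f \<in> P" "g \<in> Q" for f g
    proof (rule real_polynomial_function.intros(4))
      show "real_polynomial_function f" using P(1) \<open>f \<in> P\<close> by blast
      show "real_polynomial_function g" using Q(1) \<open>g \<in> Q\<close> by blast
    qed
    then have PQ: "?PQ \<subseteq> Collect real_polynomial_function"
      by (simp add: image_subset_iff)
    have zero: "(\<forall>h\<in>?PQ. h x = 0) \<longleftrightarrow> (\<forall>f\<in>P. f x = 0) \<or> (\<forall>g\<in>Q. g x = 0)" for x
      by auto
    have "U \<inter> V = S - {x \<in> S. \<forall>h\<in>?PQ. h x = 0}"
      unfolding P(2) Q(2) zero by blast
    with PQ show "?open (U \<inter> V)"
      by (intro exI[of _ ?PQ] conjI)
  next
    fix \<U> assume "\<forall>U\<in>\<U>. ?open U"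
    from bchoice[OF this] obtain P where P':
      "\<forall>U\<in>\<U>. P U \<subseteq> Collect real_polynomial_function \<and> U = S - {x \<in> S. \<forall>f\<in>P U. f x = 0}"
      by (rule exE)
    have P: "P U \<subseteq> Collect real_polynomial_function" "U = S - {x \<in> S. \<forall>f\<in>P U. f x = 0}"
      if "U \<in> \<U>" for U
      using conjunct1[OF bspec[OF P' that]] conjunct2[OF bspec[OF P' that]] by this
    have "\<Union>\<U> = S - {x \<in> S. \<forall>f\<in>\<Union>(P ` \<U>). f x = 0}"
    proof (intro equalityI subsetI)
      fix x assume "x \<in> \<Union>\<U>"
      then obtain U where "U \<in> \<U>" "x \<in> U" by blast
      with P(2)[OF \<open>U \<in> \<U>\<close>] show "x \<in> S - {x \<in> S. \<forall>f\<in>\<Union>(P ` \<U>). f x = 0}" by blast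
    next
      fix x assume "x \<in> S - {x \<in> S. \<forall>f\<in>\<Union>(P ` \<U>). f x = 0}"
      then obtain U where "U \<in> \<U>" "x \<in> S - {x \<in> S. \<forall>f\<in>P U. f x = 0}" by blast
      with P(2)[OF \<open>U \<in> \<U>\<close>] show "x \<in> \<Union>\<U>" by blast
    qed
    moreover have "\<Union>(P ` \<U>) \<subseteq> Collect real_polynomial_function"
      using P(1) by blast
    ultimately show "?open (\<Union>\<U>)"
      by (intro exI[of _ "\<Union>(P ` \<U>)"] conjI)
  qed
  then show ?thesis
    by (simp add: real_zariski_def)
qed

text \<open>The neighbourhoods \<open>U\<close> are open in the Zariski topology of the base \<open>B\<close>, but the
  trivialisations over them are homeomorphisms for the usual topologies.\<close>

definition zariski_locally_trivial ::
  "'e topology \<Rightarrow> 'b::euclidean_space set \<Rightarrow> ('e \<Rightarrow> 'b) \<Rightarrow> 'f topology \<Rightarrow> bool" where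
  "zariski_locally_trivial E B p F \<longleftrightarrow>
     continuous_map E (top_of_set B) p \<and>
     (\<forall>b\<in>B. \<exists>U \<phi>. b \<in> U \<and> openin (real_zariski B) U \<and>
        homeomorphic_map (subtopology E {e \<in> topspace E. p e \<in> U})
          (prod_topology (top_of_set U) F) \<phi> \<and>
        (\<forall>e\<in>topspace E. p e \<in> U \<longrightarrow> fst (\<phi> e) = p e))"

end

theory Submission
  imports Defs
begin

text \<open>
  The torus acts diagonally on \<open>r\<close>-tuples by coordinatewise multiplication. This action commutes
  with permutations, so it descends to the symmetric product, and translating by \<open>t\<close> multiplies
  both products of coordinates by the \<open>r\<close>-th powers of those of \<open>t\<close> (\<open>Sym_mult_Sym_map\<close>).
  Suppose that \<open>s\<close> is a continuous \<open>r\<close>-th root on a part \<open>U\<close> of the base: \<open>s(u)\<^sup>r = u\<close>.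
  Translating an orbit \<open>c\<close> over \<open>u\<close> by \<open>s(u)\<close> inverse moves it into the fibre over \<open>(1, 1)\<close>, which
  is \<open>SSym\<close>, and translating by \<open>s(u)\<close> moves it back. Hence the part of the symmetric product
  over \<open>U\<close> is the product of \<open>U\<close> and \<open>SSym\<close> (\<open>Sym_mult_trivialisation\<close>).

  On the circle without the point antipodal to \<open>b\<close> a branch of the \<open>r\<close>-th root exists, and
  that arc is Zariski open: it is where the polynomial \<open>1 + x \<bullet> b\<close> does not vanish. Products of
  two such arcs cover the base, which gives local triviality. Taking for \<open>U\<close> a single point
  identifies every fibre with \<open>SSym\<close>.

  The one topological subtlety is the joint continuity of the action on the symmetric product
  (\<open>continuous_map_Sym_map\<close>). It holds because the orbit map of a group of homeomorphisms is open,
  so that it remains a quotient map after taking the product with the torus.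
\<close>

section \<open>Symmetric products as functors\<close>

abbreviation power_topology :: "nat \<Rightarrow> 'a topology \<Rightarrow> (nat \<Rightarrow> 'a) topology" where
  "power_topology r X \<equiv> product_topology (\<lambda>_. X) {..<r}"

abbreviation orbit :: "nat \<Rightarrow> 'a topology \<Rightarrow> (nat \<Rightarrow> 'a) \<Rightarrow> (nat \<Rightarrow> 'a) set" where
  "orbit r X x \<equiv> perm_rel r X `` {x}"

lemma topspace_Sym: "topspace (Sym r X) = orbit r X ` topspace (power_topology r X)"
  unfolding Sym_def topspace_quotient_topology[OF equiv_perm_rel]
  by (auto simp: quotient_def)

lemma orbit_eq:
  assumes "x \<in> topspace (power_topology r X)"
  shows "orbit r X x = {x \<circ> \<sigma> | \<sigma>. \<sigma> permutes {..<r}}"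
  using assms unfolding perm_rel_def by blast

lemma continuous_map_comp_permutes:
  assumes "\<sigma> permutes {..<r}"
  shows "continuous_map (power_topology r X) (power_topology r X) (\<lambda>x. x \<circ> \<sigma>)"
  unfolding continuous_map_componentwise
proof (intro conjI ballI)
  show "(\<lambda>x. x \<circ> \<sigma>) ` topspace (power_topology r X) \<subseteq> extensional {..<r}"
    using comp_permutes_in_power[OF _ assms] by (fastforce simp: PiE_def)
  fix k assume "k \<in> {..<r}"
  then have "\<sigma> k \<in> {..<r}" using permutes_in_image[OF assms] by blast
  from continuous_map_product_projection[OF this, of "\<lambda>_. X"]
  show "continuous_map (power_topology r X) X (\<lambda>x. (x \<circ> \<sigma>) k)" by simp
qed

lemma continuous_map_orbit: "continuous_map (power_topology r X) (Sym r X) (orbit r X)"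
  unfolding continuous_map_def
proof (intro conjI allI impI)
  show "orbit r X \<in> topspace (power_topology r X) \<rightarrow> topspace (Sym r X)"
    by (auto simp: topspace_Sym)
  fix W assume "openin (Sym r X) W"
  then have W: "W \<subseteq> topspace (power_topology r X) // perm_rel r X"
    "openin (power_topology r X) (\<Union>W)"
    by (auto simp: Sym_def openin_quotient_topology[OF equiv_perm_rel])
  have "{x \<in> topspace (power_topology r X). orbit r X x \<in> W} = \<Union>W" (is "?L = _")
  proof (intro equalityI subsetI)
    fix x assume "x \<in> ?L"
    then show "x \<in> \<Union>W" using equiv_class_self[OF equiv_perm_rel] by blast
  next
    fix x assume x: "x \<in> \<Union>W"
    then obtain A where A: "A \<in> W" "x \<in> A" by blast
    have "x \<in> topspace (power_topology r X)"
      using x W(2) openin_subset by blast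
    moreover have "A \<in> topspace (power_topology r X) // perm_rel r X" using A W(1) by blast
    then have "orbit r X x = A"
      using A(2) by (metis Image_singleton_iff equiv_class_eq[OF equiv_perm_rel] quotientE)
    ultimately show "x \<in> ?L" using A by blast
  qed
  with W(2) show "openin (power_topology r X) {x \<in> topspace (power_topology r X). orbit r X x \<in> W}"
    by simp
qed

text \<open>The saturation of an open set is the union of its translates under the symmetric group, and
  each translate is open because permuting coordinates is a homeomorphism.\<close>

lemma open_map_orbit: "open_map (power_topology r X) (Sym r X) (orbit r X)"
  unfolding open_map_def
proof (intro allI impI)
  fix V assume V: "openin (power_topology r X) V"
  let ?P = "topspace (power_topology r X)"
  have VP: "V \<subseteq> ?P" using V openin_subset by blast
  have "\<Union>(orbit r X ` V) = (\<Union>\<sigma>\<in>{\<sigma>. \<sigma> permutes {..<r}}. {y \<in> ?P. y \<circ> \<sigma> \<in> V})"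
  proof (intro equalityI subsetI)
    fix y assume "y \<in> \<Union>(orbit r X ` V)"
    then obtain x where x: "x \<in> V" "(x, y) \<in> perm_rel r X" by auto
    then have "(y, x) \<in> perm_rel r X"
      using equiv_perm_rel[of X r] by (auto simp: equiv_def dest: symD)
    with x show "y \<in> (\<Union>\<sigma>\<in>{\<sigma>. \<sigma> permutes {..<r}}. {y \<in> ?P. y \<circ> \<sigma> \<in> V})"
      by (auto simp: perm_rel_def)
  next
    fix y assume "y \<in> (\<Union>\<sigma>\<in>{\<sigma>. \<sigma> permutes {..<r}}. {y \<in> ?P. y \<circ> \<sigma> \<in> V})"
    then obtain \<sigma> where \<sigma>: "\<sigma> permutes {..<r}" "y \<in> ?P" "y \<circ> \<sigma> \<in> V" by auto
    then have "(y, y \<circ> \<sigma>) \<in> perm_rel r X" unfolding perm_rel_def by blast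
    then have "(y \<circ> \<sigma>, y) \<in> perm_rel r X"
      using equiv_perm_rel[of X r] by (auto simp: equiv_def dest: symD)
    with \<sigma>(3) show "y \<in> \<Union>(orbit r X ` V)" by blast
  qed
  moreover have "openin (power_topology r X)
      (\<Union>\<sigma>\<in>{\<sigma>. \<sigma> permutes {..<r}}. {y \<in> ?P. y \<circ> \<sigma> \<in> V})"
    using openin_continuous_map_preimage[OF continuous_map_comp_permutes V] by blast
  moreover have "orbit r X ` V \<subseteq> ?P // perm_rel r X"
    using VP by (auto simp: quotient_def)
  ultimately show "openin (Sym r X) (orbit r X ` V)"
    by (simp add: Sym_def openin_quotient_topology[OF equiv_perm_rel])
qed

lemma quotient_map_orbit: "quotient_map (power_topology r X) (Sym r X) (orbit r X)"
  by (simp add: continuous_open_imp_quotient_map continuous_map_orbit open_map_orbit topspace_Sym)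

text \<open>The product of a quotient map with an identity need not be a quotient map. Here it is one,
  because the orbit map is open and openness passes to products.\<close>

lemma quotient_map_prod_orbit:
  "quotient_map (prod_topology T (power_topology r X)) (prod_topology T (Sym r X))
     (\<lambda>(t, x). (t, orbit r X x))"
proof (rule continuous_open_imp_quotient_map)
  show "continuous_map (prod_topology T (power_topology r X)) (prod_topology T (Sym r X))
     (\<lambda>(t, x). (t, orbit r X x))"
    unfolding case_prod_unfold
    by (intro continuous_map_pairedI continuous_map_fst
        continuous_map_compose[OF continuous_map_snd continuous_map_orbit, unfolded comp_def])
  show "open_map (prod_topology T (power_topology r X)) (prod_topology T (Sym r X))
     (\<lambda>(t, x). (t, orbit r X x))"
    unfolding open_map_def
  proof (intro allI impI)
    fix W assume W: "openin (prod_topology T (power_topology r X)) W"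
    show "openin (prod_topology T (Sym r X)) ((\<lambda>(t, x). (t, orbit r X x)) ` W)"
      unfolding openin_prod_topology_alt
    proof (intro allI impI)
      fix t c assume "(t, c) \<in> (\<lambda>(t, x). (t, orbit r X x)) ` W"
      then obtain x where x: "(t, x) \<in> W" "c = orbit r X x" by auto
      then obtain A B where AB: "openin T A" "openin (power_topology r X) B" "t \<in> A" "x \<in> B"
          "A \<times> B \<subseteq> W"
        using W[unfolded openin_prod_topology_alt] by meson
      have "openin (Sym r X) (orbit r X ` B)"
        using open_map_orbit AB(2) unfolding open_map_def by blast
      moreover have "A \<times> orbit r X ` B \<subseteq> (\<lambda>(t, x). (t, orbit r X x)) ` W"
        using AB(5) by force
      ultimately show "\<exists>U V. openin T U \<and> openin (Sym r X) V \<and> t \<in> U \<and> c \<in> V \<and>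
          U \<times> V \<subseteq> (\<lambda>(t, x). (t, orbit r X x)) ` W"
        using AB x by blast
    qed
  qed
  show "(\<lambda>(t, x). (t, orbit r X x)) ` topspace (prod_topology T (power_topology r X)) =
      topspace (prod_topology T (Sym r X))"
    by (force simp: topspace_Sym simp del: topspace_product_topology)
qed

text \<open>The map induced by \<open>f\<close> on symmetric products. Restriction to the index set keeps the
  tuples extensional.\<close>

definition Sym_map :: "nat \<Rightarrow> ('a \<Rightarrow> 'b) \<Rightarrow> (nat \<Rightarrow> 'a) set \<Rightarrow> (nat \<Rightarrow> 'b) set" where
  "Sym_map r f c = (\<lambda>x. restrict (f \<circ> x) {..<r}) ` c"

lemma restrict_comp_in_power:
  assumes "f \<in> topspace X \<rightarrow> topspace Y" "x \<in> topspace (power_topology r X)"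
  shows "restrict (f \<circ> x) {..<r} \<in> topspace (power_topology r Y)"
  using assms by (auto simp: PiE_iff)

lemma Sym_map_orbit:
  assumes f: "f \<in> topspace X \<rightarrow> topspace Y" and x: "x \<in> topspace (power_topology r X)"
  shows "Sym_map r f (orbit r X x) = orbit r Y (restrict (f \<circ> x) {..<r})"
proof -
  have "restrict (f \<circ> (x \<circ> \<sigma>)) {..<r} = restrict (f \<circ> x) {..<r} \<circ> \<sigma>"
    if \<sigma>: "\<sigma> permutes {..<r}" for \<sigma>
    using permutes_in_image[OF \<sigma>] by (auto simp: fun_eq_iff)
  then show ?thesis
    unfolding Sym_map_def orbit_eq[OF x] orbit_eq[OF restrict_comp_in_power[OF f x]]
    by (auto simp: image_iff) metis+
qed

lemma Sym_map_Sym_map: "Sym_map r f (Sym_map r g c) = Sym_map r (f \<circ> g) c"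
  unfolding Sym_map_def image_image by (intro image_cong) (auto simp: fun_eq_iff)

lemma Sym_map_ident:
  assumes "c \<in> topspace (Sym r X)" "\<And>x. x \<in> topspace X \<Longrightarrow> f x = x"
  shows "Sym_map r f c = c"
proof -
  obtain x where x: "x \<in> topspace (power_topology r X)" "c = orbit r X x"
    using assms(1) by (auto simp: topspace_Sym simp del: topspace_product_topology)
  have "restrict (f \<circ> x) {..<r} = x"
    using x(1) assms(2) by (auto simp: fun_eq_iff PiE_iff extensional_def)
  moreover have "f \<in> topspace X \<rightarrow> topspace X" using assms(2) by auto
  ultimately show ?thesis using Sym_map_orbit x by metis
qed

text \<open>The family \<open>f\<close> may depend on a parameter in \<open>T\<close>: the trivialisations translate each orbit by
  an element that varies with the orbit, so continuity for each fixed \<open>t\<close> would not suffice.\<close>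

lemma continuous_map_Sym_map:
  assumes f: "continuous_map (prod_topology T X) Y (\<lambda>(t, x). f t x)"
  shows "continuous_map (prod_topology T (Sym r X)) (Sym r Y) (\<lambda>(t, c). Sym_map r (f t) c)"
proof -
  have in_Y: "f t \<in> topspace X \<rightarrow> topspace Y" if "t \<in> topspace T" for t
    using continuous_map_image_subset_topspace[OF f] that by auto
  have "continuous_map (prod_topology T (power_topology r X)) (power_topology r Y)
      (\<lambda>(t, x). restrict (f t \<circ> x) {..<r})"
    unfolding continuous_map_componentwise
  proof (intro conjI ballI)
    fix k assume k: "k \<in> {..<r}"
    have "continuous_map (prod_topology T (power_topology r X)) (prod_topology T X)
        (\<lambda>z. (fst z, snd z k))"
      by (intro continuous_map_pairedI continuous_map_fst continuous_map_compose
          [OF continuous_map_snd continuous_map_product_projection[OF k], unfolded comp_def])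
    from continuous_map_compose[OF this f] k
    show "continuous_map (prod_topology T (power_topology r X)) Y
        (\<lambda>z. (case z of (t, x) \<Rightarrow> restrict (f t \<circ> x) {..<r}) k)"
      by (simp add: case_prod_unfold comp_def)
  qed auto
  from continuous_map_compose[OF this continuous_map_orbit]
  have "continuous_map (prod_topology T (power_topology r X)) (Sym r Y)
      ((\<lambda>(t, c). Sym_map r (f t) c) \<circ> (\<lambda>(t, x). (t, orbit r X x)))"
    by (rule continuous_map_eq)
      (auto simp: Sym_map_orbit[OF in_Y] simp del: topspace_product_topology)
  then show ?thesis
    by (simp only: continuous_compose_quotient_map_eq[OF quotient_map_prod_orbit])
qed

section \<open>The torus acting on its symmetric product\<close>

definition torus_mult :: "complex \<times> complex \<Rightarrow> complex \<times> complex \<Rightarrow> complex \<times> complex" where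
  "torus_mult t x = (fst t * fst x, snd t * snd x)"

definition torus_inverse :: "complex \<times> complex \<Rightarrow> complex \<times> complex" where
  "torus_inverse t = (inverse (fst t), inverse (snd t))"

definition torus_power :: "complex \<times> complex \<Rightarrow> nat \<Rightarrow> complex \<times> complex" where
  "torus_power t r = (fst t ^ r, snd t ^ r)"

lemma torus_eq: "torus = top_of_set (S1 \<times> S1)"
  by (metis prod_topology_subtopology_eu)

lemma continuous_map_torus_mult:
  "continuous_map (prod_topology torus torus) torus (\<lambda>(t, x). torus_mult t x)"
  unfolding torus_eq prod_topology_subtopology_eu torus_mult_def case_prod_unfold
  by (auto intro!: continuous_intros simp: norm_mult)

lemma continuous_map_torus_inverse: "continuous_map torus torus torus_inverse"
  unfolding torus_eq torus_inverse_def
  by (auto intro!: continuous_intros simp: norm_inverse)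

lemma continuous_map_tuple_mult: "continuous_map (power_topology r torus) torus (tuple_mult r)"
proof -
  have proj: "continuous_map (power_topology r torus) (top_of_set S1) (\<lambda>x. fst (x i))"
      "continuous_map (power_topology r torus) (top_of_set S1) (\<lambda>x. snd (x i))" if "i < r" for i
    using continuous_map_compose[OF continuous_map_product_projection[of i "{..<r}" "\<lambda>_. torus"]
        continuous_map_fst]
      continuous_map_compose[OF continuous_map_product_projection[of i "{..<r}" "\<lambda>_. torus"]
        continuous_map_snd] that
    by (simp_all add: comp_def del: prod_topology_subtopology_eu)
  have prod: "continuous_map Z (top_of_set S1) (\<lambda>z. \<Prod>i<r. f i z)"
    if f: "\<And>i. i < r \<Longrightarrow> continuous_map Z (top_of_set S1) (f i)"
    for Z :: "(nat \<Rightarrow> complex \<times> complex) topology" and f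
  proof (rule continuous_map_into_subtopology)
    show "continuous_map Z euclidean (\<lambda>z. \<Prod>i<r. f i z)"
      using continuous_map_into_fulltopology[OF f]
      by (auto simp: continuous_map_atin intro!: tendsto_prod)
    show "(\<lambda>z. \<Prod>i<r. f i z) \<in> topspace Z \<rightarrow> S1"
      using f by (auto simp: continuous_map_in_subtopology Pi_iff prod_norm[symmetric])
  qed
  show ?thesis
    unfolding tuple_mult_def by (intro continuous_map_pairedI prod proj)
qed

lemma continuous_map_Sym_mult: "continuous_map (Sym r torus) torus (Sym_mult r)"
proof -
  have "continuous_map (power_topology r torus) torus (Sym_mult r \<circ> orbit r torus)"
    using continuous_map_tuple_mult by (rule continuous_map_eq) (metis Sym_mult_class comp_apply)
  then show ?thesis
    by (simp only: continuous_compose_quotient_map_eq[OF quotient_map_orbit])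
qed

lemma Sym_mult_Sym_map:
  assumes t: "t \<in> topspace torus" and c: "c \<in> topspace (Sym r torus)"
  shows "Sym_mult r (Sym_map r (torus_mult t) c) = torus_mult (torus_power t r) (Sym_mult r c)"
proof -
  obtain x where x: "x \<in> topspace (power_topology r torus)" "c = orbit r torus x"
    using c by (auto simp: topspace_Sym simp del: topspace_product_topology)
  have f: "torus_mult t \<in> topspace torus \<rightarrow> topspace torus"
    using t by (auto simp: torus_mult_def norm_mult)
  show ?thesis
    unfolding x(2) Sym_map_orbit[OF f x(1)] Sym_mult_class[OF x(1)]
      Sym_mult_class[OF restrict_comp_in_power[OF f x(1)]]
    by (simp add: tuple_mult_def torus_mult_def torus_power_def prod.distrib)
qed

lemma SSym_eq: "SSym r = subtopology (Sym r torus) {c. Sym_mult r c = (1, 1)}"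
proof -
  have "{orbit r torus x | x. x \<in> topspace (power_topology r torus) \<and>
        (\<Prod>i<r. fst (x i)) = 1 \<and> (\<Prod>i<r. snd (x i)) = 1} =
      topspace (Sym r torus) \<inter> {c. Sym_mult r c = (1, 1)}"
    unfolding topspace_Sym
    by (auto simp: Sym_mult_class tuple_mult_def simp del: topspace_product_topology)
  then show ?thesis
    unfolding SSym_def by (metis subtopology_restrict)
qed

section \<open>Trivialisations from continuous roots\<close>

text \<open>The second component translates each orbit into the fibre over \<open>(1, 1)\<close>. Allowing any set
  \<open>U\<close> makes the lemma cover both open patches and single points.\<close>

lemma Sym_mult_trivialisation:
  assumes s: "continuous_map (top_of_set U) torus s"
    and root: "\<And>u. u \<in> U \<Longrightarrow> torus_power (s u) r = u"
    and U: "U \<subseteq> S1 \<times> S1"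
  shows "homeomorphic_map (subtopology (Sym r torus) {c \<in> topspace (Sym r torus). Sym_mult r c \<in> U})
     (prod_topology (top_of_set U) (SSym r))
     (\<lambda>c. (Sym_mult r c, Sym_map r (torus_mult (torus_inverse (s (Sym_mult r c)))) c))"
    (is "homeomorphic_map ?E _ ?\<phi>")
proof -
  let ?act = "\<lambda>t. Sym_map r (torus_mult t)"
  let ?\<psi> = "\<lambda>(u, c). ?act (s u) c"
  have act: "continuous_map (prod_topology torus (Sym r torus)) (Sym r torus) (\<lambda>(t, c). ?act t c)"
    by (rule continuous_map_Sym_map[OF continuous_map_torus_mult])
  have act_in: "?act t c \<in> topspace (Sym r torus)"
    if "t \<in> topspace torus" "c \<in> topspace (Sym r torus)" for t c
    using continuous_map_image_subset_topspace[OF act] that by auto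
  have act_cancel: "?act t (?act t' c) = c"
    if "c \<in> topspace (Sym r torus)" "\<And>x. torus_mult t (torus_mult t' x) = x" for t t' c
    using that unfolding Sym_map_Sym_map by (intro Sym_map_ident) auto
  have s_in: "s u \<in> topspace torus" if "u \<in> U" for u
    using continuous_map_image_subset_topspace[OF s] that by auto
  have inv_in: "torus_inverse t \<in> topspace torus" if "t \<in> topspace torus" for t
    using continuous_map_image_subset_topspace[OF continuous_map_torus_inverse] that by auto
  have cancel: "torus_mult t (torus_mult (torus_inverse t) x) = x"
      "torus_mult (torus_inverse t) (torus_mult t x) = x" if "t \<in> topspace torus" for t x
  proof -
    have "fst t \<noteq> 0" "snd t \<noteq> 0" using that by auto
    then show "torus_mult t (torus_mult (torus_inverse t) x) = x"
      "torus_mult (torus_inverse t) (torus_mult t x) = x"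
      by (simp_all add: torus_mult_def torus_inverse_def prod_eq_iff)
  qed
  have mult_inverse: "Sym_mult r (?act (torus_inverse (s (Sym_mult r c))) c) = (1, 1)"
    if c: "c \<in> topspace (Sym r torus)" "Sym_mult r c \<in> U" for c
  proof -
    have nz: "fst (Sym_mult r c) \<noteq> 0" "snd (Sym_mult r c) \<noteq> 0" using U c(2) by auto
    have "torus_power (torus_inverse (s (Sym_mult r c))) r = torus_inverse (Sym_mult r c)"
      by (subst (2) root[OF c(2), symmetric])
        (simp add: torus_power_def torus_inverse_def power_inverse)
    then show ?thesis
      unfolding Sym_mult_Sym_map[OF inv_in[OF s_in[OF c(2)]] c(1)]
      using nz by (simp add: torus_mult_def torus_inverse_def)
  qed
  have mult_s: "Sym_mult r (?act (s u) c) = u"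
    if "u \<in> U" "c \<in> topspace (Sym r torus)" "Sym_mult r c = (1, 1)" for u c
    using that by (simp add: Sym_mult_Sym_map[OF s_in] root torus_mult_def)
  have Sym_mult_E: "continuous_map ?E (top_of_set U) (Sym_mult r)"
  proof -
    have "continuous_map ?E (subtopology torus U) (Sym_mult r)"
      by (intro continuous_map_into_subtopology continuous_map_from_subtopology
          continuous_map_Sym_mult) auto
    moreover have "subtopology torus U = top_of_set U"
      unfolding torus_eq using U by (simp add: subtopology_subtopology Int_absorb1)
    ultimately show ?thesis by simp
  qed
  have incl: "continuous_map ?E (Sym r torus) (\<lambda>c. c)"
    by (simp add: continuous_map_from_subtopology)
  have "homeomorphic_maps ?E (prod_topology (top_of_set U) (SSym r)) ?\<phi> ?\<psi>"
    unfolding homeomorphic_maps_def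
  proof (intro conjI ballI)
    have "continuous_map ?E (prod_topology torus (Sym r torus))
        (\<lambda>c. (torus_inverse (s (Sym_mult r c)), c))"
      using continuous_map_compose[OF continuous_map_compose[OF Sym_mult_E s]
          continuous_map_torus_inverse] incl
      by (auto simp: comp_def intro!: continuous_map_pairedI)
    from continuous_map_compose[OF this act]
    have "continuous_map ?E (Sym r torus) (\<lambda>c. ?act (torus_inverse (s (Sym_mult r c))) c)"
      by (simp add: comp_def)
    then have "continuous_map ?E (SSym r) (\<lambda>c. ?act (torus_inverse (s (Sym_mult r c))) c)"
      unfolding SSym_eq using mult_inverse by (auto intro!: continuous_map_into_subtopology)
    with Sym_mult_E show "continuous_map ?E (prod_topology (top_of_set U) (SSym r)) ?\<phi>"
      by (rule continuous_map_pairedI)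
  next
    have "continuous_map (prod_topology (top_of_set U) (SSym r)) (prod_topology torus (Sym r torus))
        (\<lambda>z. (s (fst z), snd z))"
      using continuous_map_compose[OF continuous_map_fst s] continuous_map_snd
      unfolding SSym_eq comp_def
      by (intro continuous_map_pairedI) (auto intro: continuous_map_into_fulltopology)
    from continuous_map_compose[OF this act]
    have "continuous_map (prod_topology (top_of_set U) (SSym r)) (Sym r torus) ?\<psi>"
      by (simp add: comp_def case_prod_unfold)
    then show "continuous_map (prod_topology (top_of_set U) (SSym r)) ?E ?\<psi>"
      using act_in[OF s_in] mult_s
      by (intro continuous_map_into_subtopology) (auto simp: SSym_eq)
  next
    fix c assume "c \<in> topspace ?E"
    then have c: "c \<in> topspace (Sym r torus)" "Sym_mult r c \<in> U" by auto
    show "?\<psi> (?\<phi> c) = c"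
      using act_cancel[OF c(1) cancel(1)[OF s_in[OF c(2)]]] by simp
  next
    fix z assume "z \<in> topspace (prod_topology (top_of_set U) (SSym r))"
    then obtain u c where z: "z = (u, c)" "u \<in> U" "c \<in> topspace (Sym r torus)"
        "Sym_mult r c = (1, 1)"
      by (auto simp: SSym_eq)
    show "?\<phi> (?\<psi> z) = z"
      using act_cancel[OF z(3) cancel(2)[OF s_in[OF z(2)]]] mult_s[OF z(2-4)] z(1) by simp
  qed
  then show ?thesis by (rule homeomorphic_maps_imp_map)
qed

section \<open>Branches of the root on Zariski open arcs\<close>

text \<open>Dividing by \<open>b\<close> rotates the branch cut of the logarithm to the ray through \<open>- b\<close>; adding
  \<open>Ln b\<close> back makes this a root of \<open>x\<close> rather than of \<open>x / b\<close>.\<close>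

definition branch_root :: "nat \<Rightarrow> complex \<Rightarrow> complex \<Rightarrow> complex" where
  "branch_root r b x = exp ((Ln b + Ln (x / b)) / of_nat r)"

lemma branch_root_power:
  assumes "r \<ge> 1" "b \<noteq> 0" "x \<noteq> 0"
  shows "branch_root r b x ^ r = x"
  using assms unfolding branch_root_def
  by (simp add: exp_of_nat_mult[symmetric] exp_add)

lemma branch_root_in_S1:
  assumes "r \<ge> 1" "b \<in> S1" "x \<in> S1"
  shows "branch_root r b x \<in> S1"
proof -
  have "norm (branch_root r b x) ^ r = norm x"
    using assms by (subst norm_power[symmetric], subst branch_root_power) auto
  then show ?thesis
    using assms(1,3) power_eq_imp_eq_base[of "norm (branch_root r b x)" r 1] by simp
qed

lemma continuous_on_branch_root:
  assumes "b \<in> S1" "A \<subseteq> S1 - {- b}"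
  shows "continuous_on A (branch_root r b)"
proof -
  have "x / b \<notin> \<real>\<^sub>\<le>\<^sub>0" if "x \<in> A" for x
  proof
    assume "x / b \<in> \<real>\<^sub>\<le>\<^sub>0"
    then obtain a where a: "x / b = of_real a" "a \<le> 0" by (auto elim: nonpos_Reals_cases)
    have "norm (x / b) = 1" using assms that by (auto simp: norm_divide)
    then have "a = -1" using a by simp
    moreover have "b \<noteq> 0" using assms(1) by auto
    ultimately have "x = - b" using a(1) by (simp add: field_simps)
    then show False using assms that by auto
  qed
  then show ?thesis
    unfolding branch_root_def using assms
    by (cases "r = 0") (auto intro!: continuous_intros)
qed

text \<open>This expresses the removed point as the zero of a real polynomial. It rests on the identity
  \<open>\<bar>x + b\<bar>\<^sup>2 = 2 (1 + x \<bullet> b)\<close> for unit vectors.\<close>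

lemma S1_eq_minus_iff:
  assumes "x \<in> S1" "b \<in> S1"
  shows "1 + x \<bullet> b = 0 \<longleftrightarrow> x = - b"
proof -
  have "(norm (x + b))\<^sup>2 = 2 * (1 + x \<bullet> b)"
    using assms dot_norm[of x b] by simp
  then have "1 + x \<bullet> b = 0 \<longleftrightarrow> x + b = 0"
    by (metis mult_eq_0_iff norm_eq_zero zero_eq_power2 zero_neq_numeral)
  then show ?thesis by (simp add: add_eq_0_iff2)
qed

lemma openin_real_zariski_antipodal:
  assumes "b \<in> S1" "b' \<in> S1"
  shows "openin (real_zariski (S1 \<times> S1)) ((S1 - {- b}) \<times> (S1 - {- b'}))"
proof -
  let ?f = "\<lambda>z::complex \<times> complex. (1 + fst z \<bullet> b) * (1 + snd z \<bullet> b')"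
  have "real_polynomial_function ?f"
    by (intro real_polynomial_function.intros bounded_linear_intros)
  moreover have "(S1 - {- b}) \<times> (S1 - {- b'}) = S1 \<times> S1 - {z \<in> S1 \<times> S1. \<forall>f\<in>{?f}. f z = 0}"
    using S1_eq_minus_iff[OF _ assms(1)] S1_eq_minus_iff[OF _ assms(2)]
    by (auto simp: dot_square_norm simp del: mem_sphere)
  ultimately show ?thesis
    unfolding openin_real_zariski by (intro exI[of _ "{?f}"]) auto
qed

theorem proposition2p13:
  fixes r :: nat
  assumes "r \<ge> 1"
  shows "zariski_locally_trivial (Sym r torus) (S1 \<times> S1) (Sym_mult r) (SSym r) \<and>
    (\<forall>b \<in> S1 \<times> S1.
       subtopology (Sym r torus) {c \<in> topspace (Sym r torus). Sym_mult r c = b}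
         homeomorphic_space SSym r)"
proof
  let ?s = "\<lambda>b u. (branch_root r (fst b) (fst u), branch_root r (snd b) (snd u))"
  have root: "torus_power (?s b u) r = u" if "b \<in> S1 \<times> S1" "u \<in> S1 \<times> S1" for b u
  proof -
    have "fst b \<noteq> 0" "snd b \<noteq> 0" "fst u \<noteq> 0" "snd u \<noteq> 0" using that by auto
    then show ?thesis by (simp add: torus_power_def branch_root_power[OF assms] prod_eq_iff)
  qed
  have s_in: "?s b u \<in> S1 \<times> S1" if "b \<in> S1 \<times> S1" "u \<in> S1 \<times> S1" for b u
    using that branch_root_in_S1[OF assms] by (simp add: mem_Times_iff)
  show "zariski_locally_trivial (Sym r torus) (S1 \<times> S1) (Sym_mult r) (SSym r)"
    unfolding zariski_locally_trivial_def
  proof (intro conjI ballI)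
    show "continuous_map (Sym r torus) (top_of_set (S1 \<times> S1)) (Sym_mult r)"
      using continuous_map_Sym_mult torus_eq by metis
  next
    fix b assume b: "b \<in> S1 \<times> S1"
    then have b12: "fst b \<in> S1" "snd b \<in> S1" by auto
    define U where "U = (S1 - {- fst b}) \<times> (S1 - {- snd b})"
    have U: "U \<subseteq> S1 \<times> S1" by (auto simp: U_def)
    have "continuous_on U (?s b)"
      unfolding U_def
      by (intro continuous_on_Pair
          continuous_on_compose2[OF continuous_on_branch_root[OF b12(1) order_refl]]
          continuous_on_compose2[OF continuous_on_branch_root[OF b12(2) order_refl]]
          continuous_intros) auto
    then have s: "continuous_map (top_of_set U) torus (?s b)"
      unfolding torus_eq using U s_in[OF b] by (auto simp del: mem_Sigma_iff mem_sphere)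
    have "b \<in> U" using b by (auto simp: U_def)
    moreover have "openin (real_zariski (S1 \<times> S1)) U"
      unfolding U_def by (rule openin_real_zariski_antipodal[OF b12])
    moreover have "torus_power (?s b u) r = u" if "u \<in> U" for u
      using root b U that by blast
    note Sym_mult_trivialisation[OF s this U]
    ultimately show "\<exists>U \<phi>. b \<in> U \<and> openin (real_zariski (S1 \<times> S1)) U \<and>
        homeomorphic_map
          (subtopology (Sym r torus) {e \<in> topspace (Sym r torus). Sym_mult r e \<in> U})
          (prod_topology (top_of_set U) (SSym r)) \<phi> \<and>
        (\<forall>e\<in>topspace (Sym r torus). Sym_mult r e \<in> U \<longrightarrow> fst (\<phi> e) = Sym_mult r e)"
      by (intro exI conjI) auto
  qed
  show "\<forall>b \<in> S1 \<times> S1. subtopology (Sym r torus) {c \<in> topspace (Sym r torus). Sym_mult r c = b}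
         homeomorphic_space SSym r"
  proof
    fix b assume b: "b \<in> S1 \<times> S1"
    have s: "continuous_map (top_of_set {b}) torus (?s b)"
      unfolding torus_eq using s_in[OF b b] by auto
    have "torus_power (?s b u) r = u" if "u \<in> {b}" for u
      using root b that by blast
    moreover have "{b} \<subseteq> S1 \<times> S1" using b by blast
    ultimately have "subtopology (Sym r torus) {c \<in> topspace (Sym r torus). Sym_mult r c \<in> {b}}
        homeomorphic_space prod_topology (top_of_set {b}) (SSym r)"
      by (rule homeomorphic_map_imp_homeomorphic_space[OF Sym_mult_trivialisation[OF s]])
    moreover have "prod_topology (top_of_set {b}) (SSym r) homeomorphic_space SSym r"
      by (subst homeomorphic_space_sym) (rule homeomorphic_space_prod_topology_sing2, simp)
    ultimately show "subtopology (Sym r torus) {c \<in> topspace (Sym r torus). Sym_mult r c = b}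
         homeomorphic_space SSym r"
      using homeomorphic_space_trans by auto
  qed
qed

end
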